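(* Let $S$ be a finite nonempty set and, for $i=1,2$, let $B_i$ be the integral base-polyhedron defined by an integer-valued supermodular function $p_i$, with $\dot B_i=B_i\cap\mathbb{Z}^S$ and linear extension $\hat p_i$. Then $$\min\Big\{\sum_{s\in S}x(s)^2 : x\in\dot B_1\cap\dot B_2\Big\}=\max\Big\{\hat p_1(\pi_1)+\hat p_2(\pi_2)-\sum_{s\in S}\Big\lfloor\frac{\pi_1(s)+\pi_2(s)}{2}\Big\rfloor\cdot\Big\lceil\frac{\pi_1(s)+\pi_2(s)}{2}\Big\rceil : \pi_1,\pi_2\in\mathbb{Z}^S\Big\},$$ where the minimum over the empty set is $+\infty$ and the maximum is understood as a supremum.
   Context: An integral base-polyhedron defined by an integer-valued supermodular $p:2^S\to\mathbb{Z}\cup\{-\infty\}$ with $p(\emptyset)=0$, $p(S)$ finite (supermodular: $p(X)+p(Y)\le p(X\cap Y)+p(X\cup Y)$ when the left terms are finite) is $B=\{x\in\mathbb{R}^S:\widetilde x(S)=p(S),\ \widetilde x(Z)\ge p(Z)\ \forall Z\subset S\}$, $\widetilde x(Z)=\sum_{v\in Z}x(v)$, assumed nonempty. The linear (Lovász) extension is $\hat p(\pi)=p(I_n)\pi(s_n)+\sum_{j=1}^{n-1}p(I_j)[\pi(s_j)-\pi(s_{j+1})]$, where $n=|S|$, $\pi(s_1)\ge\dots\ge\pi(s_n)$, $I_j=\{s_1,\dots,s_j\}$; for supermodular $p$ it equals $\min\{\langle\pi,x\rangle:x\in B\cap\mathbb{Z}^S\}$ (possibly $-\infty$). *)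

theory Defs
  imports Complex_Main "HOL-Library.Extended_Real" "HOL-Library.FuncSet" "HOL-Library.Multiset"
begin

text \<open>Set functions with values in the integers extended by minus infinity are rendered as
  \<open>ereal\<close>-valued functions; only their values on subsets of the ground set \<open>S\<close> matter.\<close>

definition integer_valued_on :: "'a set \<Rightarrow> ('a set \<Rightarrow> ereal) \<Rightarrow> bool" where
  "integer_valued_on S p \<longleftrightarrow>
     (\<forall>X. X \<subseteq> S \<longrightarrow> p X = -\<infinity> \<or> (\<exists>k::int. p X = ereal (of_int k)))"

definition supermodular_on :: "'a set \<Rightarrow> ('a set \<Rightarrow> ereal) \<Rightarrow> bool" where
  "supermodular_on S p \<longleftrightarrow>
     (\<forall>X Y. X \<subseteq> S \<longrightarrow> Y \<subseteq> S \<longrightarrow> \<bar>p X\<bar> \<noteq> \<infinity> \<longrightarrow> \<bar>p Y\<bar> \<noteq> \<infinity> \<longrightarrow>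
        p X + p Y \<le> p (X \<inter> Y) + p (X \<union> Y))"

text \<open>Vectors indexed by \<open>S\<close> are the extensional functions on \<open>S\<close>, so that there is exactly
  one HOL function for each vector.\<close>

definition base_polyhedron :: "'a set \<Rightarrow> ('a set \<Rightarrow> ereal) \<Rightarrow> ('a \<Rightarrow> real) set" where
  "base_polyhedron S p =
     {x \<in> S \<rightarrow>\<^sub>E UNIV. ereal (\<Sum>v\<in>S. x v) = p S \<and>
        (\<forall>Z. Z \<subseteq> S \<longrightarrow> p Z \<le> ereal (\<Sum>v\<in>Z. x v))}"

definition integral_base_polyhedron_fun :: "'a set \<Rightarrow> ('a set \<Rightarrow> ereal) \<Rightarrow> bool" where
  "integral_base_polyhedron_fun S p \<longleftrightarrow>
     integer_valued_on S p \<and> supermodular_on S p \<and> p {} = 0 \<and> \<bar>p S\<bar> \<noteq> \<infinity> \<and>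
     base_polyhedron S p \<noteq> {}"

definition integral_base_points :: "'a set \<Rightarrow> ('a set \<Rightarrow> ereal) \<Rightarrow> ('a \<Rightarrow> real) set" where
  "integral_base_points S p = {x \<in> base_polyhedron S p. \<forall>s\<in>S. x s \<in> \<int>}"

definition descending_enum :: "'a set \<Rightarrow> ('a \<Rightarrow> real) \<Rightarrow> 'a list \<Rightarrow> bool" where
  "descending_enum S \<pi> xs \<longleftrightarrow>
     distinct xs \<and> set xs = S \<and> sorted_wrt (\<lambda>a b. \<pi> b \<le> \<pi> a) xs"

text \<open>Lists are indexed from 0: the element \<open>s\<^sub>j\<close> is \<open>xs ! (j - 1)\<close> and the initial segment
  \<open>I\<^sub>j = {s\<^sub>1, \<dots>, s\<^sub>j}\<close> is \<open>set (take j xs)\<close>. In \<open>ereal\<close>, \<open>0 * (-\<infinity>) = 0\<close>,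
  so segments cutting through a level set of \<open>\<pi>\<close> do not contribute.\<close>

definition lin_ext_enum :: "('a set \<Rightarrow> ereal) \<Rightarrow> ('a \<Rightarrow> real) \<Rightarrow> 'a list \<Rightarrow> ereal" where
  "lin_ext_enum p \<pi> xs =
     (let n = length xs in
        p (set (take n xs)) * ereal (\<pi> (xs ! (n - 1))) +
        (\<Sum>j = 1..n - 1. p (set (take j xs)) * ereal (\<pi> (xs ! (j - 1)) - \<pi> (xs ! j))))"

definition linear_extension :: "'a set \<Rightarrow> ('a set \<Rightarrow> ereal) \<Rightarrow> ('a \<Rightarrow> real) \<Rightarrow> ereal" where
  "linear_extension S p \<pi> = lin_ext_enum p \<pi> (SOME xs. descending_enum S \<pi> xs)"

lemma descending_enum_exists:
  assumes "finite S"
  shows "\<exists>xs. descending_enum S \<pi> xs"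
proof -
  obtain ys where ys: "distinct ys" "set ys = S"
    using finite_distinct_list[OF assms] by blast
  have "sorted_wrt (\<lambda>a b. \<pi> b \<le> \<pi> a) (sort_key (\<lambda>s. - \<pi> s) ys)"
    using sorted_sort_key[of "\<lambda>s. - \<pi> s" ys] by (simp add: sorted_map)
  with ys show ?thesis
    unfolding descending_enum_def by (intro exI[of _ "sort_key (\<lambda>s. - \<pi> s) ys"]) simp
qed

lemma descending_enum_values:
  assumes xs: "descending_enum S \<pi> xs" and ys: "descending_enum S \<pi> ys"
  shows "map \<pi> xs = map \<pi> ys"
proof -
  have m: "mset xs = mset ys"
    using assms set_eq_iff_mset_eq_distinct[of xs ys] by (auto simp: descending_enum_def)
  have s: "sorted (rev (map \<pi> zs))" if "descending_enum S \<pi> zs" for zs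
    using that by (simp add: descending_enum_def sorted_wrt_map sorted_wrt_rev rev_map)
  have "mset (rev (map \<pi> xs)) = mset (rev (map \<pi> ys))"
    using m by simp
  then have "rev (map \<pi> xs) = rev (map \<pi> ys)"
    using s[OF xs] s[OF ys] by (metis properties_for_sort)
  then show ?thesis
    by simp
qed

lemma lin_ext_enum_term:
  assumes xs: "descending_enum S \<pi> xs" and j: "1 \<le> j" "j < length xs"
  shows "p (set (take j xs)) * ereal (\<pi> (xs ! (j - 1)) - \<pi> (xs ! j)) =
         p {s \<in> S. map \<pi> xs ! (j - 1) \<le> \<pi> s} * ereal (map \<pi> xs ! (j - 1) - map \<pi> xs ! j)"
proof (cases "\<pi> (xs ! (j - 1)) = \<pi> (xs ! j)")
  case True
  then show ?thesis
    using j by (simp add: zero_ereal_def[symmetric])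
next
  case False
  have ord: "\<pi> (xs ! b) \<le> \<pi> (xs ! a)" if "a \<le> b" "b < length xs" for a b
    using xs that sorted_wrt_nth_less[of "\<lambda>a b. \<pi> b \<le> \<pi> a" xs a b]
    by (cases "a = b") (auto simp: descending_enum_def)
  have lt: "\<pi> (xs ! j) < \<pi> (xs ! (j - 1))"
    using ord[of "j - 1" j] False j by simp
  have "set (take j xs) = {s \<in> S. \<pi> (xs ! (j - 1)) \<le> \<pi> s}"
  proof (intro equalityI subsetI)
    fix s assume "s \<in> set (take j xs)"
    then obtain i where "i < j" "s = xs ! i"
      by (auto simp: in_set_conv_nth)
    then show "s \<in> {s \<in> S. \<pi> (xs ! (j - 1)) \<le> \<pi> s}"
      using ord[of i "j - 1"] j xs by (auto simp: descending_enum_def)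
  next
    fix s assume "s \<in> {s \<in> S. \<pi> (xs ! (j - 1)) \<le> \<pi> s}"
    then obtain i where i: "i < length xs" "s = xs ! i" "\<pi> (xs ! (j - 1)) \<le> \<pi> (xs ! i)"
      using xs by (auto simp: descending_enum_def in_set_conv_nth)
    have "i < j"
      using ord[of j i] i lt by (meson not_le order_trans)
    then show "s \<in> set (take j xs)"
      using i j by (auto simp: in_set_conv_nth)
  qed
  then show ?thesis
    using j by simp
qed

lemma lin_ext_enum_unique:
  assumes xs: "descending_enum S \<pi> xs" and ys: "descending_enum S \<pi> ys" and S: "S \<noteq> {}"
  shows "lin_ext_enum p \<pi> xs = lin_ext_enum p \<pi> ys"
proof -
  note v = descending_enum_values[OF xs ys]
  have l: "length xs = length ys"
    using v by (metis length_map)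
  have sets: "set xs = S" "set ys = S"
    using xs ys by (auto simp: descending_enum_def)
  have "0 < length xs"
    using S sets by auto
  then have last_eq: "\<pi> (xs ! (length xs - 1)) = \<pi> (ys ! (length ys - 1))"
    using v l by (metis diff_less nth_map zero_less_one)
  have "p (set (take j xs)) * ereal (\<pi> (xs ! (j - 1)) - \<pi> (xs ! j)) =
      p (set (take j ys)) * ereal (\<pi> (ys ! (j - 1)) - \<pi> (ys ! j))"
    if "j \<in> {1..length ys - 1}" for j
    using that lin_ext_enum_term[OF xs, of j p] lin_ext_enum_term[OF ys, of j p] v l by auto
  then have "(\<Sum>j = 1..length ys - 1. p (set (take j xs)) * ereal (\<pi> (xs ! (j - 1)) - \<pi> (xs ! j))) =
      (\<Sum>j = 1..length ys - 1. p (set (take j ys)) * ereal (\<pi> (ys ! (j - 1)) - \<pi> (ys ! j)))"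
    by (intro sum.cong) auto
  then show ?thesis
    unfolding lin_ext_enum_def Let_def using sets l last_eq by simp
qed

lemma linear_extension_eq:
  assumes "finite S" "S \<noteq> {}" "descending_enum S \<pi> xs"
  shows "linear_extension S p \<pi> = lin_ext_enum p \<pi> xs"
  unfolding linear_extension_def
  using assms by (intro lin_ext_enum_unique[OF someI]) auto

end

theory Submission
  imports Defs
begin

text \<open>The dual objective takes values in \<open>\<int> \<union> {-\<infinity>}\<close>, so it is either unbounded, in which case weak
  duality makes the primal infeasible, or attained at some \<open>(\<pi>\<^sub>1, \<pi>\<^sub>2)\<close>. In the second case, local
  optimality under the steps \<open>\<pi>\<^sub>1 + \<chi>\<^sub>X\<close>, \<open>\<pi>\<^sub>2 - \<chi>\<^sub>Y\<close> is exactly the condition under which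
  a discrete sandwich theorem with box constraints yields an integral point \<open>x\<close> in the faces of
  \<open>B\<^sub>1\<close> and \<open>B\<^sub>2\<close> minimizing \<open>\<pi>\<^sub>1\<close> and \<open>\<pi>\<^sub>2\<close>, with
  \<open>x(s)\<close> between the floor and the ceiling of \<open>(\<pi>\<^sub>1(s) + \<pi>\<^sub>2(s)) / 2\<close>. Such an \<open>x\<close>
  turns all inequalities of weak duality into equalities.\<close>

section \<open>A discrete sandwich theorem with box constraints\<close>

text \<open>A set function \<open>p\<close> with values in \<open>\<int> \<union> {-\<infinity>}\<close> is encoded by its hypograph:
  \<open>P X k\<close> stands for \<open>k \<le> p(X)\<close>, which avoids arithmetic with infinities.\<close>

definition hypo_supermodular :: "'a set \<Rightarrow> ('a set \<Rightarrow> int \<Rightarrow> bool) \<Rightarrow> bool" where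
  "hypo_supermodular S P \<longleftrightarrow> (\<forall>X Y k l. X \<subseteq> S \<longrightarrow> Y \<subseteq> S \<longrightarrow> P X k \<longrightarrow> P Y l \<longrightarrow>
     (\<exists>m n. P (X \<inter> Y) m \<and> P (X \<union> Y) n \<and> k + l \<le> m + n))"

lemma hypo_supermodularD:
  assumes "hypo_supermodular S P" "X \<subseteq> S" "Y \<subseteq> S" "P X k" "P Y l"
  obtains m n where "P (X \<inter> Y) m" "P (X \<union> Y) n" "k + l \<le> m + n"
  using assms unfolding hypo_supermodular_def by blast

text \<open>Each alternative lifts a subset of \<open>S\<close> to a set with or without
  \<open>s\<close>, and the lifted sets are uncrossed. In the mixed cases \<open>s\<close> lies only
  in the union, so \<open>t\<close> occurs once on each side; if both sets contain \<open>s\<close>,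
  it occurs twice on each side.\<close>

lemma hypo_supermodular_contract:
  assumes P: "hypo_supermodular (insert s S) P" and s: "s \<notin> S"
  shows "hypo_supermodular S (\<lambda>X k. P X k \<or> P (insert s X) (k + t))"
  unfolding hypo_supermodular_def
proof (intro allI impI)
  fix X Y k l
  assume X: "X \<subseteq> S" and Y: "Y \<subseteq> S"
    and k: "P X k \<or> P (insert s X) (k + t)" and l: "P Y l \<or> P (insert s Y) (l + t)"
  have sX: "s \<notin> X" "s \<notin> Y" using s X Y by auto
  have sub: "X \<subseteq> insert s S" "Y \<subseteq> insert s S" "insert s X \<subseteq> insert s S" "insert s Y \<subseteq> insert s S"
    using X Y by auto
  let ?P = "\<lambda>X k. P X k \<or> P (insert s X) (k + t)"
  from k l consider (00) "P X k" "P Y l" | (01) "P X k" "P (insert s Y) (l + t)"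
    | (10) "P (insert s X) (k + t)" "P Y l" | (11) "P (insert s X) (k + t)" "P (insert s Y) (l + t)"
    by blast
  then show "\<exists>m n. ?P (X \<inter> Y) m \<and> ?P (X \<union> Y) n \<and> k + l \<le> m + n"
  proof cases
    case 00
    then show ?thesis using hypo_supermodularD[OF P sub(1,2)] by metis
  next
    case 01
    obtain m n where "P (X \<inter> insert s Y) m" "P (X \<union> insert s Y) n" "k + (l + t) \<le> m + n"
      using hypo_supermodularD[OF P sub(1,4) 01] .
    then show ?thesis using sX
      by (intro exI[of _ m] exI[of _ "n - t"]) auto
  next
    case 10
    obtain m n where "P (insert s X \<inter> Y) m" "P (insert s X \<union> Y) n" "(k + t) + l \<le> m + n"
      using hypo_supermodularD[OF P sub(3,2) 10] .
    then show ?thesis using sX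
      by (intro exI[of _ m] exI[of _ "n - t"]) auto
  next
    case 11
    obtain m n where "P (insert s X \<inter> insert s Y) m" "P (insert s X \<union> insert s Y) n"
        "(k + t) + (l + t) \<le> m + n"
      using hypo_supermodularD[OF P sub(3,4) 11] .
    moreover have eq: "insert s X \<inter> insert s Y = insert s (X \<inter> Y)" by auto
    ultimately show ?thesis
      by (intro exI[of _ "m - t"] exI[of _ "n - t"]) (auto simp: eq)
  qed
qed

lemma exists_between_int_sets:
  fixes L U :: "int set"
  assumes "L \<noteq> {}" "U \<noteq> {}" "\<And>l u. l \<in> L \<Longrightarrow> u \<in> U \<Longrightarrow> l \<le> u"
  shows "\<exists>t. (\<forall>l\<in>L. l \<le> t) \<and> (\<forall>u\<in>U. t \<le> u)"
proof -
  have "bdd_above L" using assms by (meson bdd_aboveI ex_in_conv)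
  then have "\<forall>l\<in>L. l \<le> Sup L" by (blast intro: cSup_upper)
  moreover have "\<forall>u\<in>U. Sup L \<le> u" using assms by (blast intro: cSup_least)
  ultimately show ?thesis by blast
qed

text \<open>The maximum of \<open>\<langle>\<chi>\<^sub>X - \<chi>\<^sub>Y, x\<rangle>\<close> over the box \<open>f \<le> x \<le> c\<close>.\<close>

definition box_support :: "('a \<Rightarrow> int) \<Rightarrow> ('a \<Rightarrow> int) \<Rightarrow> 'a set \<Rightarrow> 'a set \<Rightarrow> int" where
  "box_support f c X Y = sum c (X - Y) - sum f (Y - X)"

lemma box_support_altdef:
  assumes "finite S" "X \<subseteq> S" "Y \<subseteq> S"
  shows "box_support f c X Y =
    (\<Sum>s\<in>S. (if s \<in> X - Y then c s else 0) - (if s \<in> Y - X then f s else 0))"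
proof -
  have "S \<inter> (X - Y) = X - Y" "S \<inter> (Y - X) = Y - X" using assms by auto
  then show ?thesis
    using sum.inter_restrict[OF assms(1), of c "X - Y"] sum.inter_restrict[OF assms(1), of f "Y - X"]
    by (simp add: box_support_def sum_subtractf)
qed

text \<open>The inequality holds element by element. At \<open>s\<close> both sides agree unless one
  pair has \<open>s\<close> only in its first set and the other pair only in its second; then the
  right side is larger by \<open>c s - f s\<close>.\<close>

lemma box_support_submodular:
  assumes S: "finite S" and fc: "\<And>s. s \<in> S \<Longrightarrow> f s \<le> c s"
    and sub: "X \<subseteq> S" "Y \<subseteq> S" "X' \<subseteq> S" "Y' \<subseteq> S"
  shows "box_support f c (X \<inter> X') (Y \<inter> Y') + box_support f c (X \<union> X') (Y \<union> Y')
    \<le> box_support f c X Y + box_support f c X' Y'"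
proof -
  note repr = box_support_altdef[OF S]
  have u: "X \<inter> X' \<subseteq> S" "Y \<inter> Y' \<subseteq> S" "X \<union> X' \<subseteq> S" "Y \<union> Y' \<subseteq> S" using sub by auto
  show ?thesis
    unfolding repr[OF sub(1,2)] repr[OF sub(3,4)] repr[OF u(1,2)] repr[OF u(3,4)]
      sum.distrib[symmetric]
    by (rule sum_mono) (use fc in force)
qed

lemma box_support_insert:
  assumes "finite X" "finite Y" "s \<notin> X" "s \<notin> Y"
  shows "box_support f c (insert s X) Y = c s + box_support f c X Y"
    and "box_support f c X (insert s Y) = box_support f c X Y - f s"
    and "box_support f c (insert s X) (insert s Y) = box_support f c X Y"
proof -
  have "insert s X - Y = insert s (X - Y)" "Y - insert s X = Y - X"
    "insert s Y - X = insert s (Y - X)" "X - insert s Y = X - Y"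
    "insert s X - insert s Y = X - Y" "insert s Y - insert s X = Y - X"
    using assms by auto
  then show "box_support f c (insert s X) Y = c s + box_support f c X Y"
    and "box_support f c X (insert s Y) = box_support f c X Y - f s"
    and "box_support f c (insert s X) (insert s Y) = box_support f c X Y"
    using assms by (simp_all add: box_support_def)
qed

text \<open>Fixing \<open>x s = t\<close> replaces \<open>p(X)\<close> by \<open>max (p(X)) (p(X \<union> {s}) - t)\<close> (and \<open>q\<close> alike with \<open>-t\<close>);
  a value \<open>t\<close> preserving the hypothesis exists because uncrossing shows that every lower bound
  on \<open>t\<close> is at most every upper bound.\<close>

lemma supermodular_sandwich:
  fixes P Q :: "'a set \<Rightarrow> int \<Rightarrow> bool" and f c :: "'a \<Rightarrow> int"
  assumes "finite S" "P {} 0" "Q {} 0" "hypo_supermodular S P" "hypo_supermodular S Q"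
    and "\<And>s. s \<in> S \<Longrightarrow> f s \<le> c s"
    and "\<And>X Y k l. X \<subseteq> S \<Longrightarrow> Y \<subseteq> S \<Longrightarrow> P X k \<Longrightarrow> Q Y l \<Longrightarrow> k + l \<le> box_support f c X Y"
  shows "\<exists>x. (\<forall>s\<in>S. f s \<le> x s \<and> x s \<le> c s) \<and> (\<forall>X k. X \<subseteq> S \<longrightarrow> P X k \<longrightarrow> k \<le> sum x X)
    \<and> (\<forall>X k. X \<subseteq> S \<longrightarrow> Q X k \<longrightarrow> k \<le> - sum x X)"
  using assms
proof (induction S arbitrary: P Q rule: finite_induct)
  case empty
  have "k \<le> 0" if "P {} k" for k
    using empty.prems(6)[of "{}" "{}" k 0] that empty.prems(2) by (simp add: box_support_def)
  moreover have "k \<le> 0" if "Q {} k" for k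
    using empty.prems(6)[of "{}" "{}" 0 k] that empty.prems(1) by (simp add: box_support_def)
  ultimately show ?case by simp
next
  case (insert s S)
  note cond = insert.prems(6)
  note fin = finite_subset[OF _ insert.hyps(1)]
  let ?\<phi> = "box_support f c"
  have ins: "?\<phi> (insert s X) Y = c s + ?\<phi> X Y" "?\<phi> X (insert s Y) = ?\<phi> X Y - f s"
      "?\<phi> (insert s X) (insert s Y) = ?\<phi> X Y" if "X \<subseteq> S" "Y \<subseteq> S" for X Y
    using that insert.hyps(2) by (auto intro!: box_support_insert fin)
  \<comment> \<open>The contracted box condition depends on \<open>t\<close> only when exactly one
    of the two sets is extended by \<open>s\<close>: extending \<open>X\<close> bounds
    \<open>t\<close> from below, extending \<open>Y\<close> from above. These bounds, with
    \<open>f s\<close> and \<open>c s\<close>, form \<open>L\<close> and \<open>U\<close>.\<close>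
  define L where "L = insert (f s)
    {k + l - ?\<phi> X Y | X Y k l. X \<subseteq> S \<and> Y \<subseteq> S \<and> P (insert s X) k \<and> Q Y l}"
  define U where "U = insert (c s)
    {?\<phi> X Y - k - l | X Y k l. X \<subseteq> S \<and> Y \<subseteq> S \<and> P X k \<and> Q (insert s Y) l}"
  have m1: "f s \<le> c s" using insert.prems(5) by simp
  have m2: "k + l - ?\<phi> X Y \<le> c s" if "X \<subseteq> S" "Y \<subseteq> S" "P (insert s X) k" "Q Y l" for X Y k l
    using cond[of "insert s X" Y k l] that ins(1)[of X Y] by (simp add: subset_insertI2)
  have m3: "f s \<le> ?\<phi> X Y - k - l" if "X \<subseteq> S" "Y \<subseteq> S" "P X k" "Q (insert s Y) l" for X Y k l
    using cond[of X "insert s Y" k l] that ins(2)[of X Y] by (simp add: subset_insertI2)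
  have m4: "k + l - ?\<phi> X Y \<le> ?\<phi> X' Y' - k' - l'"
    if 1: "X \<subseteq> S" "Y \<subseteq> S" "P (insert s X) k" "Q Y l"
      and 2: "X' \<subseteq> S" "Y' \<subseteq> S" "P X' k'" "Q (insert s Y') l'" for X Y k l X' Y' k' l'
  proof -
    \<comment> \<open>Uncrossing puts \<open>s\<close> into both unions and into neither
      intersection, so \<open>s\<close> contributes nothing to \<open>box_support\<close> for either
      resulting pair.\<close>
    have sub: "insert s X \<subseteq> insert s S" "Y \<subseteq> insert s S" "X' \<subseteq> insert s S" "insert s Y' \<subseteq> insert s S"
      using 1 2 by auto
    obtain m n where mn: "P (insert s X \<inter> X') m" "P (insert s X \<union> X') n" "k + k' \<le> m + n"
      using hypo_supermodularD[OF insert.prems(3) sub(1,3) 1(3) 2(3)] .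
    obtain m' n' where mn': "Q (Y \<inter> insert s Y') m'" "Q (Y \<union> insert s Y') n'" "l + l' \<le> m' + n'"
      using hypo_supermodularD[OF insert.prems(4) sub(2,4) 1(4) 2(4)] .
    have eq: "insert s X \<inter> X' = X \<inter> X'" "Y \<inter> insert s Y' = Y \<inter> Y'"
        "insert s X \<union> X' = insert s (X \<union> X')" "Y \<union> insert s Y' = insert s (Y \<union> Y')"
      using 1 2 insert.hyps(2) by auto
    have "m + m' \<le> ?\<phi> (X \<inter> X') (Y \<inter> Y')"
      using cond[of "X \<inter> X'" "Y \<inter> Y'" m m'] mn mn' 1 2 unfolding eq by auto
    moreover have "n + n' \<le> ?\<phi> (X \<union> X') (Y \<union> Y')"
    proof -
      have "n + n' \<le> ?\<phi> (insert s (X \<union> X')) (insert s (Y \<union> Y'))"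
        using cond[of "insert s (X \<union> X')" "insert s (Y \<union> Y')" n n'] mn mn' 1 2 unfolding eq by auto
      also have "\<dots> = ?\<phi> (X \<union> X') (Y \<union> Y')"
        using 1 2 by (intro ins(3)) auto
      finally show ?thesis .
    qed
    moreover have "?\<phi> (X \<inter> X') (Y \<inter> Y') + ?\<phi> (X \<union> X') (Y \<union> Y') \<le> ?\<phi> X Y + ?\<phi> X' Y'"
      by (rule box_support_submodular[OF insert.hyps(1)]) (use insert.prems(5) 1 2 in auto)
    ultimately show ?thesis using mn(3) mn'(3) by linarith
  qed
  have LU: "l \<le> u" if "l \<in> L" "u \<in> U" for l u
    using that unfolding L_def U_def
    by (elim insertE CollectE exE conjE; hypsubst)
      (rule m1, (rule m3; assumption), (rule m2; assumption), (rule m4; assumption))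
  have "L \<noteq> {}" "U \<noteq> {}" by (simp_all add: L_def U_def)
  then have "\<exists>t. (\<forall>l\<in>L. l \<le> t) \<and> (\<forall>u\<in>U. t \<le> u)"
    by (intro exists_between_int_sets LU)
  then obtain t where tL: "\<forall>l\<in>L. l \<le> t" and tU: "\<forall>u\<in>U. t \<le> u" by (elim exE conjE)
  let ?P = "\<lambda>X k. P X k \<or> P (insert s X) (k + t)"
  let ?Q = "\<lambda>X k. Q X k \<or> Q (insert s X) (k + - t)"
  have cond': "k + l \<le> ?\<phi> X Y" if "X \<subseteq> S" "Y \<subseteq> S" "?P X k" "?Q Y l" for X Y k l
  proof -
    have "P (insert s X) (k + t) \<Longrightarrow> Q Y l \<Longrightarrow> (k + t) + l - ?\<phi> X Y \<le> t"
      using that by (intro tL[rule_format]) (auto simp: L_def)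
    moreover have "P X k \<Longrightarrow> Q (insert s Y) (l + - t) \<Longrightarrow> t \<le> ?\<phi> X Y - k - (l + - t)"
      using that by (intro tU[rule_format]) (auto simp: U_def)
    moreover have "P X k \<Longrightarrow> Q Y l \<Longrightarrow> k + l \<le> ?\<phi> X Y" using that by (intro cond) auto
    \<comment> \<open>When both sets contain \<open>s\<close>, the contributions of \<open>t\<close>
      cancel, so this case does not constrain \<open>t\<close>.\<close>
    moreover have "(k + t) + (l + - t) \<le> ?\<phi> X Y" if "P (insert s X) (k + t)" "Q (insert s Y) (l + - t)"
    proof -
      have "(k + t) + (l + - t) \<le> ?\<phi> (insert s X) (insert s Y)"
        using that \<open>X \<subseteq> S\<close> \<open>Y \<subseteq> S\<close> by (intro cond) auto
      then show ?thesis
        using ins(3)[OF \<open>X \<subseteq> S\<close> \<open>Y \<subseteq> S\<close>] by simp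
    qed
    ultimately show ?thesis using that(3,4) by fastforce
  qed
  have "\<exists>x. (\<forall>s\<in>S. f s \<le> x s \<and> x s \<le> c s) \<and> (\<forall>X k. X \<subseteq> S \<longrightarrow> ?P X k \<longrightarrow> k \<le> sum x X)
      \<and> (\<forall>X k. X \<subseteq> S \<longrightarrow> ?Q X k \<longrightarrow> k \<le> - sum x X)"
  proof (rule insert.IH)
    show "?P {} 0" "?Q {} 0" using insert.prems(1,2) by blast+
    show "hypo_supermodular S ?P" "hypo_supermodular S ?Q"
      by (fact hypo_supermodular_contract[OF insert.prems(3) insert.hyps(2)]
          hypo_supermodular_contract[OF insert.prems(4) insert.hyps(2)])+
    show "f s' \<le> c s'" if "s' \<in> S" for s' using insert.prems(5) that by blast
    show "k + l \<le> ?\<phi> X Y" if "X \<subseteq> S" "Y \<subseteq> S" "?P X k" "?Q Y l" for X Y k l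
      using that by (rule cond')
  qed
  then obtain x where x: "\<forall>s\<in>S. f s \<le> x s \<and> x s \<le> c s"
      "\<forall>X k. X \<subseteq> S \<longrightarrow> ?P X k \<longrightarrow> k \<le> sum x X" "\<forall>X k. X \<subseteq> S \<longrightarrow> ?Q X k \<longrightarrow> k \<le> - sum x X"
    by (elim exE conjE)
  have sum_x: "sum (x(s := t)) X = (if s \<in> X then t else 0) + sum x (X - {s})" if "X \<subseteq> insert s S" for X
  proof -
    have X: "finite X" using that insert.hyps(1) finite_subset by blast
    have "sum (x(s := t)) (X - {s}) = sum x (X - {s})" by (rule sum.cong) auto
    then show ?thesis
      using sum.remove[OF X, of s "x(s := t)"] by (cases "s \<in> X") (simp_all del: fun_upd_apply, simp)
  qed
  have "k \<le> sum (x(s := t)) X" if "X \<subseteq> insert s S" "P X k" for X k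
  proof (cases "s \<in> X")
    case True
    then have "?P (X - {s}) (k - t)" using that by (simp add: insert_absorb)
    from x(2)[rule_format, OF _ this] show ?thesis
      using that True sum_x[OF that(1)] by (simp add: subset_insert_iff)
  next
    case False
    then show ?thesis
      using x(2)[rule_format, of X k] that sum_x[OF that(1)] by (simp add: subset_insert)
  qed
  moreover have "k \<le> - sum (x(s := t)) X" if "X \<subseteq> insert s S" "Q X k" for X k
  proof (cases "s \<in> X")
    case True
    then have "?Q (X - {s}) (k + t)" using that by (simp add: insert_absorb)
    from x(3)[rule_format, OF _ this] show ?thesis
      using that True sum_x[OF that(1)] by (simp add: subset_insert_iff)
  next
    case False
    then show ?thesis
      using x(3)[rule_format, of X k] that sum_x[OF that(1)] by (simp add: subset_insert)
  qed
  moreover have "f s \<le> t" "t \<le> c s" using tL tU by (auto simp: L_def U_def)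
  ultimately show ?case using x(1) by (intro exI[of _ "x(s := t)"]) auto
qed

section \<open>The linear extension as a sum over level sets\<close>

lemma ereal_sum_const:
  fixes q :: ereal
  assumes "finite A"
  shows "(\<Sum>k\<in>A. q) = q * ereal (of_nat (card A))"
  using assms
proof (induction A rule: finite_induct)
  case empty
  then show ?case by (simp flip: zero_ereal_def)
next
  case (insert k A)
  then show ?case by (cases q) (auto simp: algebra_simps)
qed

text \<open>Both sides are the sum of \<open>h\<close> over \<open>{a..m}\<close>. The additive form
  replaces a telescoping difference, which would be unsafe in the presence of -infinity.\<close>

lemma sum_int_shift:
  fixes h :: "int \<Rightarrow> 'b::comm_monoid_add"
  assumes "a \<le> m"
  shows "(\<Sum>k\<in>{a<..m}. h (k - 1)) + h m = h a + (\<Sum>k\<in>{a<..m}. h k)"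
proof -
  have "(\<Sum>k\<in>{a<..m}. h (k - 1)) = (\<Sum>k\<in>{a..<m}. h k)"
    by (rule sum.reindex_bij_witness[of _ "\<lambda>k. k + 1" "\<lambda>k. k - 1"]) auto
  moreover have "sum h {a..m} = sum h {a..<m} + h m"
  proof -
    have "{a..m} = insert m {a..<m}" using assms by auto
    then show ?thesis by (simp add: add.commute)
  qed
  moreover have "sum h {a..m} = h a + sum h {a<..m}"
  proof -
    have "{a..m} = insert a {a<..m}" using assms by auto
    then show ?thesis by simp
  qed
  ultimately show ?thesis by simp
qed

lemma sum_greaterThanAtMost_split:
  fixes h :: "int \<Rightarrow> 'b::comm_monoid_add"
  assumes "a \<le> m" "m \<le> b"
  shows "sum h {a<..b} = sum h {a<..m} + sum h {m<..b}"
proof -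
  have "{a<..b} = {a<..m} \<union> {m<..b}" using assms by auto
  then show ?thesis by (simp add: sum.union_disjoint[symmetric] ivl_disj_int_two)
qed

section \<open>Extended-valued supermodular functions and their layer formula\<close>

locale supermodular_setfun =
  fixes S :: "'a set" and p :: "'a set \<Rightarrow> ereal" and c :: int
  assumes fin: "finite S" and nonempty: "S \<noteq> {}"
    and integer_valued: "integer_valued_on S p" and supermodular: "supermodular_on S p"
    and p_empty: "p {} = 0" and p_total: "p S = ereal (of_int c)"
begin

definition lext :: "('a \<Rightarrow> int) \<Rightarrow> ereal" where
  "lext \<pi> = linear_extension S p (\<lambda>s. real_of_int (\<pi> s))"

definition level :: "('a \<Rightarrow> int) \<Rightarrow> int \<Rightarrow> 'a set" where
  "level \<pi> k = {s \<in> S. k \<le> \<pi> s}"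

lemma level_subset [simp]: "level \<pi> k \<subseteq> S"
  by (auto simp: level_def)

lemma p_cases:
  assumes "X \<subseteq> S"
  obtains "p X = -\<infinity>" | k :: int where "p X = ereal (of_int k)"
  using integer_valued assms unfolding integer_valued_on_def by blast

lemma p_super:
  assumes "X \<subseteq> S" "Y \<subseteq> S"
  shows "p X + p Y \<le> p (X \<inter> Y) + p (X \<union> Y)"
proof (cases "\<bar>p X\<bar> \<noteq> \<infinity> \<and> \<bar>p Y\<bar> \<noteq> \<infinity>")
  case True
  then show ?thesis using supermodular[unfolded supermodular_on_def, rule_format, OF assms] by simp
next
  case False
  then show ?thesis
    by (cases rule: p_cases[OF assms(1)]; cases rule: p_cases[OF assms(2)]) simp_all
qed

lemma p_inter_finite:
  assumes "X \<subseteq> S" "Y \<subseteq> S" "\<bar>p X\<bar> \<noteq> \<infinity>" "\<bar>p Y\<bar> \<noteq> \<infinity>"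
  shows "\<bar>p (X \<inter> Y)\<bar> \<noteq> \<infinity>"
proof -
  have sub: "X \<inter> Y \<subseteq> S" "X \<union> Y \<subseteq> S" using assms by auto
  show ?thesis
    using p_super[OF assms(1,2)] assms(3,4)
    by (cases rule: p_cases[OF sub(1)]; cases rule: p_cases[OF sub(2)]; cases "p X"; cases "p Y") auto
qed

text \<open>A coefficient given by the drop between consecutive values of \<open>\<pi>\<close>
  counts the integers \<open>k\<close> in that gap, and for each of them
  \<open>level \<pi> k\<close> is the corresponding initial segment. This removes the enumeration.
  The bounds \<open>a\<close> and \<open>b\<close> are left free so that several vectors can be
  compared over one common range.\<close>

lemma lext_layers:
  assumes ab: "\<And>s. s \<in> S \<Longrightarrow> a \<le> \<pi> s \<and> \<pi> s \<le> b"
  shows "lext \<pi> = ereal (of_int a) * p S + (\<Sum>k\<in>{a<..b}. p (level \<pi> k))"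
proof -
  obtain xs where xs: "descending_enum S (\<lambda>s. real_of_int (\<pi> s)) xs"
    using descending_enum_exists[OF fin] by blast
  have set_xs: "set xs = S" using xs by (simp add: descending_enum_def)
  define n where "n = length xs"
  have n: "0 < n" using set_xs nonempty by (auto simp: n_def)
  have memS: "xs ! j \<in> S" if "j < n" for j using that set_xs n_def by auto
  have desc: "\<pi> (xs ! j) \<le> \<pi> (xs ! i)" if "i \<le> j" "j < n" for i j
    using xs that sorted_wrt_nth_less[of "\<lambda>a b. real_of_int (\<pi> b) \<le> real_of_int (\<pi> a)" xs i j]
    by (cases "i = j") (auto simp: descending_enum_def n_def)
  have seg: "level \<pi> k = set (take j xs)"
    if "1 \<le> j" "j < n" "\<pi> (xs ! j) < k" "k \<le> \<pi> (xs ! (j - 1))" for j k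
  proof (intro equalityI subsetI)
    fix s assume "s \<in> level \<pi> k"
    then obtain i where i: "i < n" "s = xs ! i" "k \<le> \<pi> (xs ! i)"
      using set_xs by (auto simp: level_def in_set_conv_nth n_def)
    then have "i < j" using desc[of j i] that by (meson not_le order_trans)
    then show "s \<in> set (take j xs)" using i by (auto simp: in_set_conv_nth n_def)
  next
    fix s assume "s \<in> set (take j xs)"
    then obtain i where "i < j" "s = xs ! i" by (auto simp: in_set_conv_nth)
    then show "s \<in> level \<pi> k" using desc[of i "j - 1"] memS[of i] that by (fastforce simp: level_def)
  qed
  have tele: "(\<Sum>j = 1..m. p (set (take j xs)) * ereal (\<pi> (xs ! (j - 1)) - \<pi> (xs ! j))) =
      (\<Sum>k\<in>{\<pi> (xs ! m)<..\<pi> (xs ! 0)}. p (level \<pi> k))" if "m < n" for m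
    using that
  proof (induction m)
    case (Suc m)
    have "(\<Sum>k\<in>{\<pi> (xs ! Suc m)<..\<pi> (xs ! 0)}. p (level \<pi> k)) =
        (\<Sum>k\<in>{\<pi> (xs ! Suc m)<..\<pi> (xs ! m)}. p (level \<pi> k)) +
        (\<Sum>k\<in>{\<pi> (xs ! m)<..\<pi> (xs ! 0)}. p (level \<pi> k))"
      using desc Suc.prems by (intro sum_greaterThanAtMost_split) auto
    also have "(\<Sum>k\<in>{\<pi> (xs ! Suc m)<..\<pi> (xs ! m)}. p (level \<pi> k)) =
        (\<Sum>k\<in>{\<pi> (xs ! Suc m)<..\<pi> (xs ! m)}. p (set (take (Suc m) xs)))"
      using Suc.prems by (intro sum.cong refl arg_cong[of _ _ p] seg) auto
    also have "\<dots> = p (set (take (Suc m) xs)) * ereal (\<pi> (xs ! m) - \<pi> (xs ! Suc m))"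
      using desc[of m "Suc m"] Suc.prems by (simp add: ereal_sum_const)
    finally show ?case using Suc by (simp add: add.commute)
  qed simp
  define lo hi where "lo = \<pi> (xs ! (n - 1))" and "hi = \<pi> (xs ! 0)"
  have lohi: "a \<le> lo" "lo \<le> hi" "hi \<le> b"
    using ab memS[of 0] memS[of "n - 1"] desc[of 0 "n - 1"] n by (auto simp: lo_def hi_def)
  have range: "lo \<le> \<pi> s" "\<pi> s \<le> hi" if "s \<in> S" for s
  proof -
    have "s \<in> set xs" using that set_xs by simp
    then obtain i where "i < n" "s = xs ! i" by (auto simp: in_set_conv_nth n_def)
    then show "lo \<le> \<pi> s" "\<pi> s \<le> hi" using desc[of i "n - 1"] desc[of 0 i] by (auto simp: lo_def hi_def)
  qed
  have "lext \<pi> = lin_ext_enum p (\<lambda>s. real_of_int (\<pi> s)) xs"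
    unfolding lext_def by (rule linear_extension_eq[OF fin nonempty xs])
  also have "\<dots> = p S * ereal (of_int lo) + (\<Sum>k\<in>{lo<..hi}. p (level \<pi> k))"
    using tele[of "n - 1"] n set_xs
    by (simp add: lin_ext_enum_def Let_def n_def[symmetric] lo_def hi_def)
  \<comment> \<open>Levels above \<open>hi\<close> are empty and contribute \<open>p {} = 0\<close>.
    Levels up to \<open>lo\<close> equal \<open>S\<close>, which lets the leading coefficient drop
    from \<open>lo\<close> to \<open>a\<close>.\<close>
  also have "(\<Sum>k\<in>{lo<..hi}. p (level \<pi> k)) = (\<Sum>k\<in>{lo<..b}. p (level \<pi> k))"
  proof -
    have "level \<pi> k = {}" if "hi < k" for k using range that by (force simp: level_def)
    then show ?thesis
      using lohi p_empty sum_greaterThanAtMost_split[of lo hi b "\<lambda>k. p (level \<pi> k)"] by simp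
  qed
  also have "p S * ereal (of_int lo) = ereal (of_int a) * p S + (\<Sum>k\<in>{a<..lo}. p (level \<pi> k))"
  proof -
    have "level \<pi> k = S" if "k \<le> lo" for k using range that by (force simp: level_def)
    then have "(\<Sum>k\<in>{a<..lo}. p (level \<pi> k)) = (\<Sum>k\<in>{a<..lo}. p S)" by (intro sum.cong) auto
    then show ?thesis using lohi by (simp add: p_total ereal_sum_const algebra_simps)
  qed
  also have "\<dots> + (\<Sum>k\<in>{lo<..b}. p (level \<pi> k)) =
      ereal (of_int a) * p S + (\<Sum>k\<in>{a<..b}. p (level \<pi> k))"
    using lohi sum_greaterThanAtMost_split[of a lo b "\<lambda>k. p (level \<pi> k)"] by (simp add: add.assoc)
  finally show ?thesis .
qed

section \<open>Supermodularity, integrality and translation of the extension\<close>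

lemma bounds_exist:
  fixes \<pi> :: "'a \<Rightarrow> int"
  shows "\<exists>a b. \<forall>s\<in>S. a < \<pi> s \<and> \<pi> s < b"
proof -
  have "finite (\<pi> ` S)" using fin by simp
  from Min_le[OF this] Max_ge[OF this] have "\<forall>s\<in>S. Min (\<pi> ` S) - 1 < \<pi> s \<and> \<pi> s < Max (\<pi> ` S) + 1"
    by force
  then show ?thesis by (intro exI)
qed

lemma lext_zero: "lext (\<lambda>s. 0) = 0"
  using lext_layers[of 0 "\<lambda>s. 0" 0] by (simp add: p_total)

lemma lext_cong:
  assumes "\<And>s. s \<in> S \<Longrightarrow> \<pi> s = \<rho> s"
  shows "lext \<pi> = lext \<rho>"
proof -
  obtain a b where ab: "\<forall>s\<in>S. a < \<pi> s \<and> \<pi> s < b"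
    using bounds_exist by blast
  have "level \<pi> = level \<rho>" using assms by (auto simp: level_def fun_eq_iff)
  then show ?thesis using ab assms lext_layers[of a \<pi> b] lext_layers[of a \<rho> b] by (simp add: less_imp_le)
qed

text \<open>The level sets of the minimum and the maximum are the intersections and unions of the
  level sets, so \<open>p_super\<close> can be summed over the layers of a common range.\<close>

lemma lext_supermodular:
  "lext \<pi> + lext \<rho> \<le> lext (\<lambda>s. min (\<pi> s) (\<rho> s)) + lext (\<lambda>s. max (\<pi> s) (\<rho> s))"
proof -
  obtain a b1 where "\<forall>s\<in>S. a < min (\<pi> s) (\<rho> s) \<and> min (\<pi> s) (\<rho> s) < b1"
    using bounds_exist[of "\<lambda>s. min (\<pi> s) (\<rho> s)"] by blast
  moreover obtain a2 b where "\<forall>s\<in>S. a2 < max (\<pi> s) (\<rho> s) \<and> max (\<pi> s) (\<rho> s) < b"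
    using bounds_exist[of "\<lambda>s. max (\<pi> s) (\<rho> s)"] by blast
  ultimately have ab: "\<forall>s\<in>S. a < \<pi> s \<and> \<pi> s < b \<and> a < \<rho> s \<and> \<rho> s < b" by simp
  have lay:
    "lext \<pi> = ereal (of_int a) * p S + (\<Sum>k\<in>{a<..b}. p (level \<pi> k))"
    "lext \<rho> = ereal (of_int a) * p S + (\<Sum>k\<in>{a<..b}. p (level \<rho> k))"
    "lext (\<lambda>s. min (\<pi> s) (\<rho> s)) =
      ereal (of_int a) * p S + (\<Sum>k\<in>{a<..b}. p (level (\<lambda>s. min (\<pi> s) (\<rho> s)) k))"
    "lext (\<lambda>s. max (\<pi> s) (\<rho> s)) =
      ereal (of_int a) * p S + (\<Sum>k\<in>{a<..b}. p (level (\<lambda>s. max (\<pi> s) (\<rho> s)) k))"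
    by (rule lext_layers; use ab in \<open>force simp: min_def max_def\<close>)+
  have "(\<Sum>k\<in>{a<..b}. p (level \<pi> k)) + (\<Sum>k\<in>{a<..b}. p (level \<rho> k)) \<le>
     (\<Sum>k\<in>{a<..b}. p (level (\<lambda>s. min (\<pi> s) (\<rho> s)) k)) + (\<Sum>k\<in>{a<..b}. p (level (\<lambda>s. max (\<pi> s) (\<rho> s)) k))"
    unfolding sum.distrib[symmetric]
  proof (rule sum_mono)
    fix k
    have "level (\<lambda>s. min (\<pi> s) (\<rho> s)) k = level \<pi> k \<inter> level \<rho> k"
      "level (\<lambda>s. max (\<pi> s) (\<rho> s)) k = level \<pi> k \<union> level \<rho> k" by (auto simp: level_def)
    then show "p (level \<pi> k) + p (level \<rho> k) \<le>
      p (level (\<lambda>s. min (\<pi> s) (\<rho> s)) k) + p (level (\<lambda>s. max (\<pi> s) (\<rho> s)) k)"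
      using p_super by simp
  qed
  from add_left_mono[OF this, of "ereal (of_int a) * p S + ereal (of_int a) * p S"]
  show ?thesis unfolding lay by (simp only: ac_simps)
qed

text \<open>By \<open>lext_layers\<close> the value is a finite sum of elements of a set closed
  under addition. Integrality is what later turns boundedness of the dual into attainment.\<close>

lemma lext_cases:
  obtains "lext \<pi> = -\<infinity>" | k :: int where "lext \<pi> = ereal (of_int k)"
proof -
  let ?I = "insert (-\<infinity>) (range (\<lambda>k::int. ereal (of_int k)))"
  have of_int_mem: "ereal (of_int k) \<in> ?I" for k :: int by blast
  have add: "u + w \<in> ?I" if "u \<in> ?I" "w \<in> ?I" for u w
  proof -
    have "ereal (of_int k) + ereal (of_int l) \<in> ?I" for k l
      using of_int_mem[of "k + l"] by simp
    then show ?thesis using that by (elim insertE rangeE) (simp_all del: plus_ereal.simps(1))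
  qed
  have sum: "(\<Sum>k\<in>A. p (level \<pi> k)) \<in> ?I" for A
  proof (induction A rule: infinite_finite_induct)
    case (insert k A)
    have "p (level \<pi> k) \<in> ?I" by (cases rule: p_cases[OF level_subset[of \<pi> k]]) auto
    then show ?case unfolding sum.insert[OF insert.hyps] using insert.IH by (rule add)
  qed (use of_int_mem[of 0] in \<open>simp_all flip: zero_ereal_def\<close>)
  obtain a b where ab: "\<forall>s\<in>S. a < \<pi> s \<and> \<pi> s < b"
    using bounds_exist by blast
  have "lext \<pi> = ereal (of_int a) * p S + (\<Sum>k\<in>{a<..b}. p (level \<pi> k))"
    by (rule lext_layers) (use ab in force)
  also have "ereal (of_int a) * p S = ereal (of_int (a * c))" by (simp add: p_total)
  finally have "lext \<pi> \<in> ?I" using add[OF of_int_mem sum] by (rule ssubst)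
  then show ?thesis using that by blast
qed

text \<open>The level sets move with the range of summation, so only the term \<open>a * p S\<close>
  changes.\<close>

lemma lext_translate: "lext (\<lambda>s. \<pi> s + m) = lext \<pi> + ereal (of_int (m * c))"
proof -
  obtain a b where ab: "\<forall>s\<in>S. a < \<pi> s \<and> \<pi> s < b"
    using bounds_exist by blast
  have "(\<Sum>k\<in>{a + m<..b + m}. p (level (\<lambda>s. \<pi> s + m) k)) = (\<Sum>k\<in>{a<..b}. p (level \<pi> k))"
    by (rule sum.reindex_bij_witness[of _ "\<lambda>k. k + m" "\<lambda>k. k - m"]) (auto simp: level_def algebra_simps)
  moreover have "lext (\<lambda>s. \<pi> s + m) = ereal (of_int (a + m)) * p S +
      (\<Sum>k\<in>{a + m<..b + m}. p (level (\<lambda>s. \<pi> s + m) k))"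
    using ab by (intro lext_layers) force
  moreover have "lext \<pi> = ereal (of_int a) * p S + (\<Sum>k\<in>{a<..b}. p (level \<pi> k))"
    using ab by (intro lext_layers) force
  ultimately show ?thesis
    by (cases "\<Sum>k\<in>{a<..b}. p (level \<pi> k)") (simp_all add: p_total algebra_simps)
qed

text \<open>This is the layer formula for the modular function \<open>sum x\<close>, obtained by
  exchanging the two sums. It allows \<open>lext\<close> and the inner product to be compared level
  by level.\<close>

lemma sum_layers:
  fixes x :: "'a \<Rightarrow> real"
  assumes ab: "\<And>s. s \<in> S \<Longrightarrow> a \<le> \<pi> s \<and> \<pi> s \<le> b"
  shows "(\<Sum>s\<in>S. of_int (\<pi> s) * x s) = of_int a * sum x S + (\<Sum>k\<in>{a<..b}. sum x (level \<pi> k))"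
proof -
  have "(\<Sum>k\<in>{a<..b}. sum x (level \<pi> k)) = (\<Sum>k\<in>{a<..b}. \<Sum>s\<in>S. if k \<le> \<pi> s then x s else 0)"
    unfolding level_def by (intro sum.cong refl sum.inter_filter[OF fin])
  also have "\<dots> = (\<Sum>s\<in>S. \<Sum>k\<in>{a<..b}. if k \<le> \<pi> s then x s else 0)"
    by (rule sum.swap)
  also have "\<dots> = (\<Sum>s\<in>S. of_int (\<pi> s - a) * x s)"
  proof (rule sum.cong[OF refl])
    fix s assume s: "s \<in> S"
    have "(\<Sum>k\<in>{a<..b}. if k \<le> \<pi> s then x s else 0) = (\<Sum>k\<in>{k \<in> {a<..b}. k \<le> \<pi> s}. x s)"
      by (rule sum.inter_filter[symmetric]) simp
    also have "{k \<in> {a<..b}. k \<le> \<pi> s} = {a<..\<pi> s}" using ab[OF s] by auto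
    finally show "(\<Sum>k\<in>{a<..b}. if k \<le> \<pi> s then x s else 0) = of_int (\<pi> s - a) * x s"
      using ab[OF s] by simp
  qed
  finally show ?thesis by (simp add: algebra_simps sum.distrib sum_subtractf sum_distrib_left)
qed

text \<open>On each layer \<open>p\<close> is at most \<open>sum x\<close>. Equality on
  \<open>S\<close> takes care of the coefficient \<open>a\<close>, whose sign is unknown.\<close>

lemma lext_le_inner:
  assumes x: "x \<in> base_polyhedron S p"
  shows "lext \<pi> \<le> ereal (\<Sum>s\<in>S. of_int (\<pi> s) * x s)"
proof -
  obtain a b where ab: "\<forall>s\<in>S. a < \<pi> s \<and> \<pi> s < b"
    using bounds_exist by blast
  have le: "p Z \<le> ereal (sum x Z)" if "Z \<subseteq> S" for Z using x that by (auto simp: base_polyhedron_def)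
  have eq: "sum x S = of_int c" using x by (auto simp: base_polyhedron_def p_total)
  have "lext \<pi> = ereal (of_int a) * p S + (\<Sum>k\<in>{a<..b}. p (level \<pi> k))"
    using ab by (intro lext_layers) force
  also have "\<dots> \<le> ereal (of_int a) * p S + (\<Sum>k\<in>{a<..b}. ereal (sum x (level \<pi> k)))"
    by (intro add_left_mono sum_mono le) simp
  also have "\<dots> = ereal (\<Sum>s\<in>S. of_int (\<pi> s) * x s)"
    using ab by (subst sum_layers[of a \<pi> b]) (auto simp: p_total eq less_imp_le)
  finally show ?thesis .
qed

section \<open>The face on which an integral weight vector is minimal\<close>

lemma level_add_indicator:
  "level (\<lambda>s. \<pi> s + of_bool (s \<in> X)) k = level \<pi> k \<union> (X \<inter> level \<pi> (k - 1))"
  by (auto simp: level_def)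

text \<open>The hypothesis on \<open>x\<close> describes the face of the base polyhedron on which \<open>\<pi>\<close> is minimal:
  \<open>X \<mapsto> lext (\<pi> + \<chi>\<^sub>X) - lext \<pi>\<close> is the supermodular function defining that face.\<close>

lemma
  fixes x :: "'a \<Rightarrow> real" and v :: real
  assumes v: "lext \<pi> = ereal v"
    and up: "\<And>X. X \<subseteq> S \<Longrightarrow> lext (\<lambda>s. \<pi> s + of_bool (s \<in> X)) \<le> ereal (v + sum x X)"
    and tot: "sum x S = of_int c"
  shows face_point_feasible: "\<And>Z. Z \<subseteq> S \<Longrightarrow> p Z \<le> ereal (sum x Z)"
    and face_point_inner: "(\<Sum>s\<in>S. of_int (\<pi> s) * x s) \<le> v"
proof -
  obtain a b where ab: "\<forall>s\<in>S. a < \<pi> s \<and> \<pi> s < b"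
    using bounds_exist by blast
  have a_b: "a \<le> b" using ab nonempty by force
  let ?L = "level \<pi>"
  have v_eq: "ereal v = ereal (of_int a * of_int c) + (\<Sum>k\<in>{a<..b}. p (?L k))"
    using lext_layers[of a \<pi> b] ab v by (auto simp: p_total less_imp_le)
  have lay: "lext (\<lambda>s. \<pi> s + of_bool (s \<in> X)) = ereal (of_int a * of_int c) +
      (\<Sum>k\<in>{a<..b}. p (?L k \<union> (X \<inter> ?L (k - 1))))" for X
    using lext_layers[of a "\<lambda>s. \<pi> s + of_bool (s \<in> X)" b] ab
    by (force simp: p_total level_add_indicator)
  have "\<bar>\<Sum>k\<in>{a<..b}. p (?L k)\<bar> \<noteq> \<infinity>"
    using v_eq by (cases "\<Sum>k\<in>{a<..b}. p (?L k)") auto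
  then have L_fin: "\<bar>p (?L k)\<bar> \<noteq> \<infinity>" if "k \<in> {a<..b}" for k
    using that by (auto simp: sum_Inf)
  \<comment> \<open>The strictness of both bounds matters here: it makes the extreme levels
    \<open>S\<close> and empty, and it keeps the vector within the range after a unit step
    upwards.\<close>
  have L_a: "?L a = S" and L_b: "?L b = {}" using ab by (force simp: level_def)+
  show "p Z \<le> ereal (sum x Z)" if Z: "Z \<subseteq> S" for Z
  proof (cases rule: p_cases[OF Z])
    case (2 z)
    \<comment> \<open>Uncrossing level \<open>k\<close> with the part of \<open>Z\<close> in level
      \<open>k - 1\<close> yields \<open>Z\<close> within level \<open>k\<close> and the level
      \<open>k\<close> of the raised vector. Summed over \<open>k\<close>, the \<open>H\<close>
      terms telescope, leaving \<open>lext \<pi> + p Z\<close> at most the extension of the raised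
      vector.\<close>
    define H where "H = (\<lambda>k. p (Z \<inter> ?L k))"
    have "(\<Sum>k\<in>{a<..b}. p (?L k)) + (\<Sum>k\<in>{a<..b}. H (k - 1)) \<le>
        (\<Sum>k\<in>{a<..b}. H k) + (\<Sum>k\<in>{a<..b}. p (?L k \<union> (Z \<inter> ?L (k - 1))))"
      unfolding sum.distrib[symmetric]
    proof (rule sum_mono)
      fix k
      have "?L k \<inter> (Z \<inter> ?L (k - 1)) = Z \<inter> ?L k" by (auto simp: level_def)
      then show "p (?L k) + H (k - 1) \<le> H k + p (?L k \<union> (Z \<inter> ?L (k - 1)))"
        using p_super[of "?L k" "Z \<inter> ?L (k - 1)"] Z by (auto simp: H_def)
    qed
    moreover have "(\<Sum>k\<in>{a<..b}. H (k - 1)) = p Z + (\<Sum>k\<in>{a<..b}. H k)"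
    proof -
      have "H b = 0" "H a = p Z" using Z by (auto simp: H_def L_a L_b p_empty Int_absorb2)
      then show ?thesis using sum_int_shift[OF a_b, of H] by simp
    qed
    moreover have "\<bar>\<Sum>k\<in>{a<..b}. H k\<bar> \<noteq> \<infinity>"
      using p_inter_finite[OF Z level_subset _ L_fin] 2 by (auto simp: sum_Inf H_def)
    ultimately show ?thesis
      using up[OF Z] v_eq 2 unfolding lay
      by (cases "\<Sum>k\<in>{a<..b}. H k"; cases "\<Sum>k\<in>{a<..b}. p (?L k)";
          cases "\<Sum>k\<in>{a<..b}. p (?L k \<union> (Z \<inter> ?L (k - 1)))") auto
  qed simp
  have L_le: "ereal (sum x (?L m)) \<le> p (?L m)" if m: "m \<in> {a<..b}" for m
  proof -
    \<comment> \<open>Raising the complement of level \<open>m\<close> shifts the levels up to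
      \<open>m\<close> by one and keeps the others, so the extension changes by
      \<open>p S - p (?L m)\<close>. Since \<open>sum x S\<close> is the integer \<open>c\<close>,
      the hypothesis \<open>up\<close> for this complement becomes an upper bound on
      \<open>sum x (?L m)\<close>.\<close>
    have "?L k \<union> ((S - ?L m) \<inter> ?L (k - 1)) = (if k \<le> m then ?L (k - 1) else ?L k)" for k
      by (auto simp: level_def)
    then have "(\<Sum>k\<in>{a<..b}. p (?L k \<union> ((S - ?L m) \<inter> ?L (k - 1)))) =
        (\<Sum>k\<in>{a<..m}. p (?L (k - 1))) + (\<Sum>k\<in>{m<..b}. p (?L k))"
      using m by (subst sum_greaterThanAtMost_split[of a m b]) auto
    moreover have "(\<Sum>k\<in>{a<..m}. p (?L (k - 1))) + p (?L m) = p S + (\<Sum>k\<in>{a<..m}. p (?L k))"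
      using sum_int_shift[of a m "\<lambda>k. p (?L k)"] m by (simp add: L_a)
    moreover have "(\<Sum>k\<in>{a<..b}. p (?L k)) = (\<Sum>k\<in>{a<..m}. p (?L k)) + (\<Sum>k\<in>{m<..b}. p (?L k))"
      using m by (intro sum_greaterThanAtMost_split) auto
    moreover have "sum x (S - ?L m) = of_int c - sum x (?L m)"
      using fin tot by (simp add: sum_diff)
    ultimately show ?thesis
      using up[of "S - ?L m"] v_eq L_fin[OF m] unfolding lay
      by (cases "p (?L m)"; cases "\<Sum>k\<in>{a<..m}. p (?L k)"; cases "\<Sum>k\<in>{m<..b}. p (?L k)";
          cases "\<Sum>k\<in>{a<..m}. p (?L (k - 1))") (auto simp: p_total)
  qed
  have "ereal (\<Sum>s\<in>S. of_int (\<pi> s) * x s) =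
      ereal (of_int a * of_int c) + (\<Sum>k\<in>{a<..b}. ereal (sum x (?L k)))"
    using ab by (subst sum_layers[of a \<pi> b]) (auto simp: tot less_imp_le)
  also have "\<dots> \<le> ereal (of_int a * of_int c) + (\<Sum>k\<in>{a<..b}. p (?L k))"
    by (intro add_left_mono sum_mono L_le)
  finally show "(\<Sum>s\<in>S. of_int (\<pi> s) * x s) \<le> v" by (simp add: v_eq[symmetric])
qed

text \<open>Neither value on the right can be +infinity, so a finite lower bound on their sum forces
  both to be integers.\<close>

lemma lext_supermodular_int:
  assumes "ereal (of_int k) \<le> lext \<pi>" "ereal (of_int l) \<le> lext \<rho>"
  shows "\<exists>m n :: int. lext (\<lambda>s. min (\<pi> s) (\<rho> s)) = ereal (of_int m) \<and>
    lext (\<lambda>s. max (\<pi> s) (\<rho> s)) = ereal (of_int n) \<and> k + l \<le> m + n"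
proof -
  have le: "ereal (of_int k) + ereal (of_int l) \<le> lext (\<lambda>s. min (\<pi> s) (\<rho> s)) + lext (\<lambda>s. max (\<pi> s) (\<rho> s))"
    using add_mono[OF assms] lext_supermodular by (rule order_trans)
  show ?thesis
  proof (cases rule: lext_cases[of "\<lambda>s. min (\<pi> s) (\<rho> s)"])
    case 1
    then show ?thesis using le by (cases rule: lext_cases[of "\<lambda>s. max (\<pi> s) (\<rho> s)"]) simp_all
  next
    case m: (2 m)
    show ?thesis
    proof (cases rule: lext_cases[of "\<lambda>s. max (\<pi> s) (\<rho> s)"])
      case 1
      then show ?thesis using le m by simp
    next
      case (2 n)
      then have "real_of_int (k + l) \<le> of_int (m + n)" using le m by simp
      then show ?thesis using m 2 by (simp only: of_int_le_iff) simp
    qed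
  qed
qed

text \<open>The minimum and maximum of the two raised vectors are raised on
  \<open>X \<inter> Y\<close> and \<open>X \<union> Y\<close>. The offset \<open>v\<close> is later
  the value at \<open>\<pi>\<close>, which normalizes the set function at the empty set.\<close>

lemma hypo_supermodular_lext_add:
  "hypo_supermodular S (\<lambda>X k. ereal (of_int (v + k)) \<le> lext (\<lambda>s. \<pi> s + of_bool (s \<in> X)))"
  unfolding hypo_supermodular_def
proof (intro allI impI)
  fix X Y k l
  assume "ereal (of_int (v + k)) \<le> lext (\<lambda>s. \<pi> s + of_bool (s \<in> X))"
    "ereal (of_int (v + l)) \<le> lext (\<lambda>s. \<pi> s + of_bool (s \<in> Y))"
  from lext_supermodular_int[OF this] obtain m n where
    mn: "lext (\<lambda>s. min (\<pi> s + of_bool (s \<in> X)) (\<pi> s + of_bool (s \<in> Y))) = ereal (of_int m)"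
      "lext (\<lambda>s. max (\<pi> s + of_bool (s \<in> X)) (\<pi> s + of_bool (s \<in> Y))) = ereal (of_int n)"
      "(v + k) + (v + l) \<le> m + n"
    by (elim exE conjE)
  have "(\<lambda>s. min (\<pi> s + of_bool (s \<in> X)) (\<pi> s + of_bool (s \<in> Y))) = (\<lambda>s. \<pi> s + of_bool (s \<in> X \<inter> Y))"
    "(\<lambda>s. max (\<pi> s + of_bool (s \<in> X)) (\<pi> s + of_bool (s \<in> Y))) = (\<lambda>s. \<pi> s + of_bool (s \<in> X \<union> Y))"
    by auto
  with mn show "\<exists>m n. ereal (of_int (v + m)) \<le> lext (\<lambda>s. \<pi> s + of_bool (s \<in> X \<inter> Y)) \<and>
      ereal (of_int (v + n)) \<le> lext (\<lambda>s. \<pi> s + of_bool (s \<in> X \<union> Y)) \<and> k + l \<le> m + n"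
    by (intro exI[of _ "m - v"] exI[of _ "n - v"]) simp
qed

text \<open>Lowering reverses the order: the minimum now belongs to the union and the maximum to the
  intersection, hence the exchanged witnesses.\<close>

lemma hypo_supermodular_lext_diff:
  "hypo_supermodular S (\<lambda>X k. ereal (of_int (v + k)) \<le> lext (\<lambda>s. \<pi> s - of_bool (s \<in> X)))"
  unfolding hypo_supermodular_def
proof (intro allI impI)
  fix X Y k l
  assume "ereal (of_int (v + k)) \<le> lext (\<lambda>s. \<pi> s - of_bool (s \<in> X))"
    "ereal (of_int (v + l)) \<le> lext (\<lambda>s. \<pi> s - of_bool (s \<in> Y))"
  from lext_supermodular_int[OF this] obtain m n where
    mn: "lext (\<lambda>s. min (\<pi> s - of_bool (s \<in> X)) (\<pi> s - of_bool (s \<in> Y))) = ereal (of_int m)"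
      "lext (\<lambda>s. max (\<pi> s - of_bool (s \<in> X)) (\<pi> s - of_bool (s \<in> Y))) = ereal (of_int n)"
      "(v + k) + (v + l) \<le> m + n"
    by (elim exE conjE)
  have "(\<lambda>s. min (\<pi> s - of_bool (s \<in> X)) (\<pi> s - of_bool (s \<in> Y))) = (\<lambda>s. \<pi> s - of_bool (s \<in> X \<union> Y))"
    "(\<lambda>s. max (\<pi> s - of_bool (s \<in> X)) (\<pi> s - of_bool (s \<in> Y))) = (\<lambda>s. \<pi> s - of_bool (s \<in> X \<inter> Y))"
    by auto
  with mn show "\<exists>m n. ereal (of_int (v + m)) \<le> lext (\<lambda>s. \<pi> s - of_bool (s \<in> X \<inter> Y)) \<and>
      ereal (of_int (v + n)) \<le> lext (\<lambda>s. \<pi> s - of_bool (s \<in> X \<union> Y)) \<and> k + l \<le> m + n"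
    by (intro exI[of _ "n - v"] exI[of _ "m - v"]) simp
qed

lemma base_point_restrict:
  assumes "\<And>Z. Z \<subseteq> S \<Longrightarrow> p Z \<le> ereal (\<Sum>s\<in>Z. of_int (x s))" "sum x S = c"
  shows "restrict (\<lambda>s. of_int (x s)) S \<in> integral_base_points S p"
proof -
  have "(\<Sum>s\<in>Z. restrict (\<lambda>s. real_of_int (x s)) S s) = (\<Sum>s\<in>Z. of_int (x s))" if "Z \<subseteq> S" for Z
    using that by (intro sum.cong) auto
  then show ?thesis
    using assms by (auto simp: integral_base_points_def base_polyhedron_def p_total of_int_sum[symmetric]
        simp del: of_int_sum)
qed

end

section \<open>Duality\<close>

lemma supermodular_setfun_integral_base_polyhedron:
  assumes "finite S" "S \<noteq> {}" "integral_base_polyhedron_fun S p"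
  obtains c where "supermodular_setfun S p c"
proof -
  have "p S = -\<infinity> \<or> (\<exists>c::int. p S = ereal (of_int c))" "\<bar>p S\<bar> \<noteq> \<infinity>"
    using assms(3) by (auto simp: integral_base_polyhedron_fun_def integer_valued_on_def)
  then obtain c :: int where "p S = ereal (of_int c)" by auto
  then show ?thesis
    using assms by (intro that[of c]) (simp add: supermodular_setfun_def integral_base_polyhedron_fun_def)
qed

text \<open>The maximum of \<open>m * x - x\<^sup>2\<close> over integers \<open>x\<close>.\<close>

definition sq_conj :: "int \<Rightarrow> int" where
  "sq_conj m = (m div 2) * ((m + 1) div 2)"

section \<open>The integer conjugate of the square\<close>

lemma sq_conj_floor_ceiling:
  "\<lfloor>(real_of_int m + real_of_int n) / 2\<rfloor> * \<lceil>(real_of_int m + real_of_int n) / 2\<rceil> = sq_conj (m + n)"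
proof -
  have "\<lfloor>real_of_int (m + n) / real_of_int 2\<rfloor> = (m + n) div 2"
    by (rule floor_divide_of_int_eq)
  moreover have "\<lceil>real_of_int (m + n) / real_of_int 2\<rceil> = - (- (m + n) div 2)"
    by (rule ceiling_divide_eq_div)
  moreover have "- (- (m + n) div 2) = (m + n + 1) div 2" by presburger
  ultimately show ?thesis by (simp add: sq_conj_def)
qed

text \<open>The forward and backward differences are the ceiling and the floor of
  \<open>m / 2\<close>; they become the upper and lower bounds of the box.\<close>

lemma sq_conj_add_diff:
  "sq_conj (m + 1) = sq_conj m + (m + 1) div 2" "sq_conj (m - 1) = sq_conj m - m div 2"
proof -
  have *: "(m + 1 + 1) div 2 = m div 2 + 1" "(m - 1) div 2 = (m + 1) div 2 - 1" by presburger+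
  show "sq_conj (m + 1) = sq_conj m + (m + 1) div 2" "sq_conj (m - 1) = sq_conj m - m div 2"
    by (simp_all only: sq_conj_def * diff_add_cancel) (simp_all only: algebra_simps)
qed

text \<open>No integer lies strictly between the floor and the ceiling of \<open>m / 2\<close>, so
  the product of the two differences is nonnegative. Its roots add up to \<open>m\<close>.\<close>

lemma sq_conj_ge: "m * x - sq_conj m \<le> x\<^sup>2"
proof -
  have "0 \<le> (x - m div 2) * (x - (m + 1) div 2)"
  proof (cases "x \<le> m div 2")
    case True
    then show ?thesis by (intro mult_nonpos_nonpos) auto
  next
    case False
    then show ?thesis by (intro mult_nonneg_nonneg) auto
  qed
  also have "\<dots> = x\<^sup>2 - (m div 2 + (m + 1) div 2) * x + sq_conj m"
    by (simp add: sq_conj_def power2_eq_square algebra_simps)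
  also have "m div 2 + (m + 1) div 2 = m" by presburger
  finally show ?thesis by simp
qed

lemma sq_conj_eq:
  assumes "m div 2 \<le> x" "x \<le> (m + 1) div 2"
  shows "m * x - sq_conj m = x\<^sup>2"
proof -
  have "x = m div 2 \<or> x = (m + 1) div 2" using assms by presburger
  then have "0 = (x - m div 2) * (x - (m + 1) div 2)" by auto
  also have "\<dots> = x\<^sup>2 - (m div 2 + (m + 1) div 2) * x + sq_conj m"
    by (simp add: sq_conj_def power2_eq_square algebra_simps)
  also have "m div 2 + (m + 1) div 2 = m" by presburger
  finally show ?thesis by simp
qed

text \<open>An element of both sets is not moved, and any other moves by at most one. This
  identifies local optimality of the dual with the box condition of the sandwich theorem.\<close>

lemma sum_sq_conj_step:
  assumes "finite S" "X \<subseteq> S" "Y \<subseteq> S"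
  shows "(\<Sum>s\<in>S. sq_conj (\<mu> s + of_bool (s \<in> X) - of_bool (s \<in> Y))) =
    (\<Sum>s\<in>S. sq_conj (\<mu> s)) + box_support (\<lambda>s. \<mu> s div 2) (\<lambda>s. (\<mu> s + 1) div 2) X Y"
  unfolding box_support_altdef[OF assms] sum.distrib[symmetric]
  by (rule sum.cong) (auto simp: sq_conj_add_diff)

lemma dual_optimum_attained:
  fixes \<pi>1 \<pi>2 :: "'a \<Rightarrow> int" and v1 v2 :: int
  assumes p1: "supermodular_setfun S p1 c1" and p2: "supermodular_setfun S p2 c2"
  defines "l1 \<equiv> supermodular_setfun.lext S p1" and "l2 \<equiv> supermodular_setfun.lext S p2"
  assumes v1: "l1 \<pi>1 = ereal (of_int v1)" and v2: "l2 \<pi>2 = ereal (of_int v2)"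
    and opt: "\<And>\<rho>1 \<rho>2 k l. ereal (of_int k) \<le> l1 \<rho>1 \<Longrightarrow> ereal (of_int l) \<le> l2 \<rho>2 \<Longrightarrow>
      k + l - (\<Sum>s\<in>S. sq_conj (\<rho>1 s + \<rho>2 s)) \<le> v1 + v2 - (\<Sum>s\<in>S. sq_conj (\<pi>1 s + \<pi>2 s))"
  obtains x where "x \<in> integral_base_points S p1 \<inter> integral_base_points S p2"
    "(\<Sum>s\<in>S. (x s)\<^sup>2) \<le> of_int (v1 + v2 - (\<Sum>s\<in>S. sq_conj (\<pi>1 s + \<pi>2 s)))"
proof -
  interpret A: supermodular_setfun S p1 c1 by fact
  interpret B: supermodular_setfun S p2 c2 by fact
  note fin = A.fin
  have l [simp]: "l1 = A.lext" "l2 = B.lext" by (simp_all add: l1_def l2_def)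
  define \<mu> where "\<mu> = (\<lambda>s. \<pi>1 s + \<pi>2 s)"
  let ?P = "\<lambda>X k. ereal (of_int (v1 + k)) \<le> A.lext (\<lambda>s. \<pi>1 s + of_bool (s \<in> X))"
  let ?Q = "\<lambda>X k. ereal (of_int (v2 + k)) \<le> B.lext (\<lambda>s. \<pi>2 s - of_bool (s \<in> X))"
  have "\<exists>x. (\<forall>s\<in>S. \<mu> s div 2 \<le> x s \<and> x s \<le> (\<mu> s + 1) div 2) \<and>
      (\<forall>X k. X \<subseteq> S \<longrightarrow> ?P X k \<longrightarrow> k \<le> sum x X) \<and> (\<forall>X k. X \<subseteq> S \<longrightarrow> ?Q X k \<longrightarrow> k \<le> - sum x X)"
  proof (rule supermodular_sandwich[OF fin])
    show "?P {} 0" "?Q {} 0" using v1 v2 by simp_all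
    show "hypo_supermodular S ?P" by (rule A.hypo_supermodular_lext_add)
    show "hypo_supermodular S ?Q" by (rule B.hypo_supermodular_lext_diff)
    show "\<mu> s div 2 \<le> (\<mu> s + 1) div 2" for s by presburger
    fix X Y k l
    assume XY: "X \<subseteq> S" "Y \<subseteq> S" and kl: "?P X k" "?Q Y l"
    have "(\<Sum>s\<in>S. sq_conj (\<pi>1 s + of_bool (s \<in> X) + (\<pi>2 s - of_bool (s \<in> Y)))) =
        (\<Sum>s\<in>S. sq_conj (\<mu> s + of_bool (s \<in> X) - of_bool (s \<in> Y)))"
      by (intro sum.cong) (auto simp: \<mu>_def algebra_simps)
    also have "\<dots> = (\<Sum>s\<in>S. sq_conj (\<pi>1 s + \<pi>2 s)) +
        box_support (\<lambda>s. \<mu> s div 2) (\<lambda>s. (\<mu> s + 1) div 2) X Y"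
      unfolding sum_sq_conj_step[OF fin XY] by (simp add: \<mu>_def)
    finally show "k + l \<le> box_support (\<lambda>s. \<mu> s div 2) (\<lambda>s. (\<mu> s + 1) div 2) X Y"
      using opt[unfolded l, OF kl] by linarith
  qed
  then obtain x where
    box: "\<forall>s\<in>S. \<mu> s div 2 \<le> x s \<and> x s \<le> (\<mu> s + 1) div 2" and
    P: "\<forall>X k. X \<subseteq> S \<longrightarrow> ?P X k \<longrightarrow> k \<le> sum x X" and
    Q: "\<forall>X k. X \<subseteq> S \<longrightarrow> ?Q X k \<longrightarrow> k \<le> - sum x X"
    by (elim exE conjE)
  note xP = P[rule_format] and xQ = Q[rule_format]
  have tr1: "A.lext (\<lambda>s. \<pi>1 s + m) = ereal (of_int (v1 + m * c1))" for m
    using A.lext_translate[of \<pi>1 m] v1 by simp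
  have tr2: "B.lext (\<lambda>s. \<pi>2 s + m) = ereal (of_int (v2 + m * c2))" for m
    using B.lext_translate[of \<pi>2 m] v2 by simp
  \<comment> \<open>Testing \<open>x\<close> on all of \<open>S\<close> gives
    \<open>c1 \<le> sum x S \<le> c2\<close>. Conversely, lowering \<open>\<pi>1\<close> and raising
    \<open>\<pi>2\<close> by one everywhere leaves the conjugate term unchanged, so optimality gives
    \<open>c2 \<le> c1\<close>.\<close>
  have "?P S c1"
    using A.lext_cong[of "\<lambda>s. \<pi>1 s + of_bool (s \<in> S)" "\<lambda>s. \<pi>1 s + 1"] tr1[of 1] by simp
  then have "c1 \<le> sum x S" by (rule xP[OF order_refl])
  moreover have "?Q S (- c2)"
    using B.lext_cong[of "\<lambda>s. \<pi>2 s - of_bool (s \<in> S)" "\<lambda>s. \<pi>2 s + (-1)"] tr2[of "-1"] by simp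
  then have "- c2 \<le> - sum x S" by (rule xQ[OF order_refl])
  moreover have "c2 \<le> c1"
    using opt[of "v1 - c1" "\<lambda>s. \<pi>1 s + (-1)" "v2 + c2" "\<lambda>s. \<pi>2 s + 1"] tr1[of "-1"] tr2[of 1] by simp
  ultimately have tot: "sum x S = c1" "sum x S = c2" by auto
  have up1: "A.lext (\<lambda>s. \<pi>1 s + of_bool (s \<in> X)) \<le> ereal (of_int v1 + (\<Sum>s\<in>X. of_int (x s)))"
    if "X \<subseteq> S" for X
  proof (cases rule: A.lext_cases[of "\<lambda>s. \<pi>1 s + of_bool (s \<in> X)"])
    case (2 k)
    then have "k - v1 \<le> sum x X" by (intro xP[OF that]) simp
    then have "real_of_int k \<le> of_int (v1 + sum x X)" by (subst of_int_le_iff) simp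
    then show ?thesis using 2 by simp
  qed simp
  have up2: "B.lext (\<lambda>s. \<pi>2 s + of_bool (s \<in> X)) \<le> ereal (of_int v2 + (\<Sum>s\<in>X. of_int (x s)))"
    if X: "X \<subseteq> S" for X
  proof -
    \<comment> \<open>The sandwich theorem controls only downward steps of \<open>\<pi>2\<close>.
      Raising \<open>X\<close> amounts to lowering \<open>S - X\<close> and translating by
      one.\<close>
    have eq: "B.lext (\<lambda>s. \<pi>2 s + of_bool (s \<in> X)) =
        B.lext (\<lambda>s. \<pi>2 s - of_bool (s \<in> S - X)) + ereal (of_int c2)"
      using B.lext_cong[of "\<lambda>s. \<pi>2 s + of_bool (s \<in> X)" "\<lambda>s. \<pi>2 s - of_bool (s \<in> S - X) + 1"]
        B.lext_translate[of "\<lambda>s. \<pi>2 s - of_bool (s \<in> S - X)" 1] by auto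
    show ?thesis
    proof (cases rule: B.lext_cases[of "\<lambda>s. \<pi>2 s - of_bool (s \<in> S - X)"])
      case (2 k)
      then have "k - v2 \<le> - sum x (S - X)" by (intro xQ) auto
      also have "\<dots> = sum x X - c2" using X fin tot by (simp add: sum_diff)
      finally have "real_of_int (k + c2) \<le> of_int (v2 + sum x X)" by (subst of_int_le_iff) simp
      then show ?thesis using 2 eq by simp
    qed (simp add: eq)
  qed
  have tot': "(\<Sum>s\<in>S. real_of_int (x s)) = of_int c1" "(\<Sum>s\<in>S. real_of_int (x s)) = of_int c2"
    using tot by (simp_all flip: of_int_sum)
  note f1 = A.face_point_feasible[OF v1[unfolded l] up1 tot'(1)]
    and i1 = A.face_point_inner[OF v1[unfolded l] up1 tot'(1)]
    and f2 = B.face_point_feasible[OF v2[unfolded l] up2 tot'(2)]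
    and i2 = B.face_point_inner[OF v2[unfolded l] up2 tot'(2)]
  show ?thesis
  proof
    show "restrict (\<lambda>s. of_int (x s)) S \<in> integral_base_points S p1 \<inter> integral_base_points S p2"
      using A.base_point_restrict[OF f1 tot(1)] B.base_point_restrict[OF f2 tot(2)] by blast
    have "(\<Sum>s\<in>S. (restrict (\<lambda>s. real_of_int (x s)) S s)\<^sup>2) = of_int (\<Sum>s\<in>S. (x s)\<^sup>2)"
      by simp
    also have "(\<Sum>s\<in>S. (x s)\<^sup>2) = (\<Sum>s\<in>S. \<mu> s * x s - sq_conj (\<mu> s))"
      using box by (intro sum.cong) (auto simp: sq_conj_eq)
    also have "real_of_int \<dots> = (\<Sum>s\<in>S. of_int (\<pi>1 s) * of_int (x s)) +
        (\<Sum>s\<in>S. of_int (\<pi>2 s) * of_int (x s)) - of_int (\<Sum>s\<in>S. sq_conj (\<mu> s))"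
      by (simp add: \<mu>_def sum_subtractf sum.distrib algebra_simps)
    also have "\<dots> \<le> of_int (v1 + v2 - (\<Sum>s\<in>S. sq_conj (\<pi>1 s + \<pi>2 s)))"
      using i1 i2 by (simp add: \<mu>_def)
    finally show "(\<Sum>s\<in>S. (restrict (\<lambda>s. real_of_int (x s)) S s)\<^sup>2) \<le>
      of_int (v1 + v2 - (\<Sum>s\<in>S. sq_conj (\<pi>1 s + \<pi>2 s)))" .
  qed
qed

text \<open>Weak duality adds \<open>lext_le_inner\<close> for both functions to the conjugate
  inequality at each element. Integrality of \<open>x\<close> is essential, since
  \<open>sq_conj\<close> is a conjugate over the integers.\<close>

lemma dual_le_primal:
  assumes p1: "supermodular_setfun S p1 c1" and p2: "supermodular_setfun S p2 c2"
    and x: "x \<in> integral_base_points S p1 \<inter> integral_base_points S p2"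
  shows "supermodular_setfun.lext S p1 \<pi>1 + supermodular_setfun.lext S p2 \<pi>2
      - ereal (of_int (\<Sum>s\<in>S. sq_conj (\<pi>1 s + \<pi>2 s))) \<le> ereal (\<Sum>s\<in>S. (x s)\<^sup>2)"
proof -
  interpret A: supermodular_setfun S p1 c1 by fact
  interpret B: supermodular_setfun S p2 c2 by fact
  have "of_int (\<pi>1 s + \<pi>2 s) * x s - of_int (sq_conj (\<pi>1 s + \<pi>2 s)) \<le> (x s)\<^sup>2" if s: "s \<in> S" for s
  proof -
    have "x s \<in> \<int>" using x s by (simp add: integral_base_points_def)
    then obtain k where "x s = of_int k" by (elim Ints_cases)
    moreover have "real_of_int ((\<pi>1 s + \<pi>2 s) * k - sq_conj (\<pi>1 s + \<pi>2 s)) \<le> of_int (k\<^sup>2)"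
      by (subst of_int_le_iff) (rule sq_conj_ge)
    ultimately show ?thesis by simp
  qed
  from sum_mono[OF this]
  have le: "(\<Sum>s\<in>S. of_int (\<pi>1 s) * x s) + (\<Sum>s\<in>S. of_int (\<pi>2 s) * x s)
      - of_int (\<Sum>s\<in>S. sq_conj (\<pi>1 s + \<pi>2 s)) \<le> (\<Sum>s\<in>S. (x s)\<^sup>2)"
    by (simp add: sum_subtractf sum.distrib algebra_simps)
  have "A.lext \<pi>1 + B.lext \<pi>2 \<le> ereal ((\<Sum>s\<in>S. of_int (\<pi>1 s) * x s) + (\<Sum>s\<in>S. of_int (\<pi>2 s) * x s))"
    using add_mono[OF A.lext_le_inner B.lext_le_inner, of x x \<pi>1 \<pi>2] x
    by (simp add: integral_base_points_def)
  then show ?thesis using le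
    by (cases "A.lext \<pi>1"; cases "B.lext \<pi>2") auto
qed

text \<open>The objective takes nonnegative integer values on \<open>I\<close>, so well-ordering of
  the natural numbers provides a minimizer.\<close>

lemma integral_points_least_square_norm:
  assumes I: "I \<noteq> {}" "\<And>x s. x \<in> I \<Longrightarrow> s \<in> S \<Longrightarrow> x s \<in> \<int>"
  shows "\<exists>x\<in>I. \<forall>y\<in>I. (\<Sum>s\<in>S. (x s)\<^sup>2) \<le> (\<Sum>s\<in>S. (y s :: real)\<^sup>2)"
proof -
  let ?q = "\<lambda>x. \<Sum>s\<in>S. (x s :: real)\<^sup>2"
  have int: "?q x = of_int \<lfloor>?q x\<rfloor>" if "x \<in> I" for x
  proof -
    have "?q x \<in> \<int>" using I(2) that by (intro Ints_sum Ints_power)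
    then show ?thesis by (elim Ints_cases) simp
  qed
  obtain z where "z \<in> I" using I by blast
  then obtain x where x: "x \<in> I" "\<And>y. y \<in> I \<Longrightarrow> nat \<lfloor>?q x\<rfloor> \<le> nat \<lfloor>?q y\<rfloor>"
    using ex_has_least_nat[of "\<lambda>x. x \<in> I" z "\<lambda>x. nat \<lfloor>?q x\<rfloor>"] by metis
  have "?q x \<le> ?q y" if "y \<in> I" for y
  proof -
    have "0 \<le> ?q x" "0 \<le> ?q y" by (simp_all add: sum_nonneg)
    then have "\<lfloor>?q x\<rfloor> \<le> \<lfloor>?q y\<rfloor>" using x(2)[OF that] by (simp add: nat_le_eq_zle)
    then show ?thesis using int[OF x(1)] int[OF that] by (metis of_int_le_iff)
  qed
  then show ?thesis using x(1) by blast
qed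

theorem theorem7p12:
  fixes S :: "'a set" and p1 p2 :: "'a set \<Rightarrow> ereal"
  assumes "finite S" and "S \<noteq> {}"
    and "integral_base_polyhedron_fun S p1"
    and "integral_base_polyhedron_fun S p2"
  shows "(INF x\<in>integral_base_points S p1 \<inter> integral_base_points S p2. ereal (\<Sum>s\<in>S. (x s)\<^sup>2)) =
      (SUP (\<pi>1, \<pi>2) \<in> (S \<rightarrow>\<^sub>E (UNIV :: int set)) \<times> (S \<rightarrow>\<^sub>E (UNIV :: int set)).
         linear_extension S p1 (\<lambda>s. real_of_int (\<pi>1 s)) +
         linear_extension S p2 (\<lambda>s. real_of_int (\<pi>2 s)) -
         ereal (real_of_int (\<Sum>s\<in>S. \<lfloor>(real_of_int (\<pi>1 s) + real_of_int (\<pi>2 s)) / 2\<rfloor> *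
                                    \<lceil>(real_of_int (\<pi>1 s) + real_of_int (\<pi>2 s)) / 2\<rceil>)))
    \<and> (integral_base_points S p1 \<inter> integral_base_points S p2 \<noteq> {} \<longrightarrow>
        (\<exists>x\<in>integral_base_points S p1 \<inter> integral_base_points S p2.
           \<forall>y\<in>integral_base_points S p1 \<inter> integral_base_points S p2.
             (\<Sum>s\<in>S. (x s)\<^sup>2) \<le> (\<Sum>s\<in>S. (y s)\<^sup>2)))"
proof -
  let ?I = "integral_base_points S p1 \<inter> integral_base_points S p2"
  let ?E = "S \<rightarrow>\<^sub>E (UNIV :: int set)"
  obtain c1 where p1: "supermodular_setfun S p1 c1"
    by (rule supermodular_setfun_integral_base_polyhedron[OF assms(1-3)])
  obtain c2 where p2: "supermodular_setfun S p2 c2"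
    by (rule supermodular_setfun_integral_base_polyhedron[OF assms(1,2,4)])
  interpret A: supermodular_setfun S p1 c1 by fact
  interpret B: supermodular_setfun S p2 c2 by fact
  define q where "q = (\<lambda>\<pi>1 \<pi>2. \<Sum>s\<in>S. sq_conj (\<pi>1 s + \<pi>2 s))"
  define D where "D = (\<lambda>\<pi>1 \<pi>2. A.lext \<pi>1 + B.lext \<pi>2 - ereal (of_int (q \<pi>1 \<pi>2)))"
  define P where "P = (INF x\<in>?I. ereal (\<Sum>s\<in>S. (x s)\<^sup>2))"
  define M where "M = (SUP (\<pi>1, \<pi>2) \<in> ?E \<times> ?E. D \<pi>1 \<pi>2)"
  have "M \<le> P"
    unfolding M_def P_def
  proof (intro SUP_least INF_greatest)
    fix z x assume "x \<in> ?I"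
    from dual_le_primal[OF p1 p2 this, of "fst z" "snd z"]
    show "(case z of (\<pi>1, \<pi>2) \<Rightarrow> D \<pi>1 \<pi>2) \<le> ereal (\<Sum>s\<in>S. (x s)\<^sup>2)"
      by (simp add: D_def q_def case_prod_unfold)
  qed
  \<comment> \<open>The unit steps and translations need not stay extensional, so the bound is
    extended to arbitrary functions by restriction to \<open>S\<close>.\<close>
  have D_le: "D \<pi>1 \<pi>2 \<le> M" for \<pi>1 \<pi>2
  proof -
    have "A.lext (restrict \<pi>1 S) = A.lext \<pi>1" by (rule A.lext_cong) simp
    moreover have "B.lext (restrict \<pi>2 S) = B.lext \<pi>2" by (rule B.lext_cong) simp
    moreover have "q (restrict \<pi>1 S) (restrict \<pi>2 S) = q \<pi>1 \<pi>2" by (simp add: q_def)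
    ultimately have "D (restrict \<pi>1 S) (restrict \<pi>2 S) = D \<pi>1 \<pi>2" by (simp add: D_def)
    moreover have "D (restrict \<pi>1 S) (restrict \<pi>2 S) \<le> M"
      unfolding M_def by (rule SUP_upper2[of "(restrict \<pi>1 S, restrict \<pi>2 S)"]) auto
    ultimately show ?thesis by simp
  qed
  have "P \<le> M"
  proof (cases "M = \<infinity>")
    case False
    then obtain r where "M \<le> ereal r" by (cases M) auto
    \<comment> \<open>\<open>V\<close> holds of the finite dual values, all integers. The zero
      vectors give the value 0, so the search for a maximum can be confined to nonnegative values
      and carried out in the natural numbers.\<close>
    define V where "V = (\<lambda>v. \<exists>\<pi>1 \<pi>2 k l. A.lext \<pi>1 = ereal (of_int k) \<and> B.lext \<pi>2 = ereal (of_int l)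
      \<and> v = k + l - q \<pi>1 \<pi>2)"
    have "V 0"
      unfolding V_def
      by (intro exI[of _ "\<lambda>s. 0"] exI[of _ 0])
        (simp add: A.lext_zero B.lext_zero q_def sq_conj_def zero_ereal_def[symmetric])
    have V_D: "ereal (of_int v) \<le> M" if "V v" for v
    proof -
      from that obtain \<pi>1 \<pi>2 k l where "A.lext \<pi>1 = ereal (of_int k)" "B.lext \<pi>2 = ereal (of_int l)"
        "v = k + l - q \<pi>1 \<pi>2" unfolding V_def by (elim exE conjE)
      then show ?thesis using D_le[of \<pi>1 \<pi>2] by (simp add: D_def)
    qed
    have bound: "\<forall>v. V v \<and> 0 \<le> v \<longrightarrow> nat v < nat (\<lfloor>r\<rfloor> + 1)"
    proof (intro allI impI)
      fix v assume v: "V v \<and> 0 \<le> v"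
      then have "ereal (of_int v) \<le> ereal r"
        using V_D \<open>M \<le> ereal r\<close> by (blast intro: order_trans)
      then have "v \<le> \<lfloor>r\<rfloor>" by (simp add: le_floor_iff)
      then show "nat v < nat (\<lfloor>r\<rfloor> + 1)" using v by linarith
    qed
    obtain v where v: "V v" "0 \<le> v" and v_max: "\<forall>w. V w \<and> 0 \<le> w \<longrightarrow> nat w \<le> nat v"
      using ex_has_greatest_nat[of "\<lambda>v. V v \<and> 0 \<le> v" 0 nat, OF _ bound] \<open>V 0\<close> by auto
    have max: "w \<le> v" if "V w" for w
      using v_max[rule_format, of w] that v(2) by (cases "0 \<le> w") auto
    from v(1) obtain \<pi>1 \<pi>2 v1 v2 where
      opt: "A.lext \<pi>1 = ereal (of_int v1)" "B.lext \<pi>2 = ereal (of_int v2)" "v = v1 + v2 - q \<pi>1 \<pi>2"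
      unfolding V_def by (elim exE conjE)
    have step: "k + l - (\<Sum>s\<in>S. sq_conj (\<rho>1 s + \<rho>2 s)) \<le> v1 + v2 - (\<Sum>s\<in>S. sq_conj (\<pi>1 s + \<pi>2 s))"
      if k: "ereal (of_int k) \<le> A.lext \<rho>1" and l: "ereal (of_int l) \<le> B.lext \<rho>2" for \<rho>1 \<rho>2 k l
    proof -
      obtain k' where k': "A.lext \<rho>1 = ereal (of_int k')" using k by (cases rule: A.lext_cases[of \<rho>1]) auto
      obtain l' where l': "B.lext \<rho>2 = ereal (of_int l')" using l by (cases rule: B.lext_cases[of \<rho>2]) auto
      have "V (k' + l' - q \<rho>1 \<rho>2)" unfolding V_def using k' l' by blast
      from max[OF this] show ?thesis using k l k' l' opt(3) by (simp add: q_def)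
    qed
    obtain x where x: "x \<in> ?I" "(\<Sum>s\<in>S. (x s)\<^sup>2) \<le> of_int v"
      using dual_optimum_attained[OF p1 p2 opt(1,2) step] opt(3) unfolding q_def by blast
    have "P \<le> ereal (\<Sum>s\<in>S. (x s)\<^sup>2)" unfolding P_def by (rule INF_lower[OF x(1)])
    also have "\<dots> \<le> ereal (of_int v)" using x(2) by simp
    also have "\<dots> \<le> M" by (rule V_D[OF v(1)])
    finally show ?thesis .
  qed simp
  with \<open>M \<le> P\<close> have "P = M" by simp
  moreover have "?I \<noteq> {} \<longrightarrow> (\<exists>x\<in>?I. \<forall>y\<in>?I. (\<Sum>s\<in>S. (x s)\<^sup>2) \<le> (\<Sum>s\<in>S. (y s)\<^sup>2))"
    by (intro impI integral_points_least_square_norm) (auto simp: integral_base_points_def)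
  ultimately show ?thesis
    by (simp only: P_def M_def D_def q_def A.lext_def B.lext_def sq_conj_floor_ceiling)
qed

end
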